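(* Let $(\Omega,\mathcal{F},P)$ be a probability space, let $\boldsymbol{Y}\in LLn_2$ and let $\mathcal{H}\subset\mathcal{G}$ be two sub-$\sigma$-algebras of $\mathcal{F}$. Then, up to a set of $P$-measure $0$, the following hold: 1) $E_\ell[\boldsymbol{Y}\,|\,\{\emptyset,\Omega\}]=E_\ell[\boldsymbol{Y}]$. 2) $E_\ell\big[E_\ell[\boldsymbol{Y}\,|\,\mathcal{G}]\,\big|\,\mathcal{H}\big]=E_\ell[\boldsymbol{Y}\,|\,\mathcal{H}]$. 3) If $\boldsymbol{Y}_1,\dots,\boldsymbol{Y}_k\in LLn_2$ and $w_1,\dots,w_k\in\mathbb{R}$, then $$E_\ell\Big[\prod_{i=1}^k\boldsymbol{Y}_i^{w_i}\,\Big|\,\mathcal{G}\Big]=\prod_{i=1}^k\Big(E_\ell[\boldsymbol{Y}_i\,|\,\mathcal{G}]\Big)^{w_i}.$$ 4) If $\boldsymbol{Y}$ is independent of $\mathcal{G}$ (in the standard sense), then $E_\ell[\boldsymbol{Y}\,|\,\mathcal{G}]=E_\ell[\boldsymbol{Y}]$.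
   Context: All operations on vectors (products, powers, $\ln$, $\exp$) are componentwise. $Ln_2$ is the set of $P$-a.e. finite and strictly positive ($(0,\infty)^n$-valued) random variables $\boldsymbol{X}=(X_1,\dots,X_n)$ with $E[|\ln X_i|^2]<\infty$ for all $i$; $L_2$ is the set of random vectors with $E[|X_i|^2]<\infty$ for all $i$; $LLn_2=L_2\cap Ln_2$. For $\boldsymbol{Y}\in Ln_2$ and a sub-$\sigma$-algebra $\mathcal{G}$ of $\mathcal{F}$, the $\ell$-conditional expectation is $E_\ell[\boldsymbol{Y}\,|\,\mathcal{G}]=\exp\left(E[\ln\boldsymbol{Y}\,|\,\mathcal{G}]\right)$, and the $\ell$-expected value is $E_\ell[\boldsymbol{Y}]=\exp(E[\ln\boldsymbol{Y}])$. *)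

theory Defs
  imports "HOL-Probability.Probability"
begin

text \<open>Products of vectors are the library's componentwise \<open>(*)\<close> and \<open>\<Prod>\<close> on \<open>real ^ 'n\<close>;
  the remaining componentwise operations are defined here.\<close>

definition vec_ln :: "real ^ 'n \<Rightarrow> real ^ 'n"
  where "vec_ln v = (\<chi> i. ln (v $ i))"

definition vec_exp :: "real ^ 'n \<Rightarrow> real ^ 'n"
  where "vec_exp v = (\<chi> i. exp (v $ i))"

definition vec_powr :: "real ^ 'n \<Rightarrow> real \<Rightarrow> real ^ 'n"
  where "vec_powr v w = (\<chi> i. (v $ i) powr w)"

text \<open>Random vectors are real-valued, hence finite everywhere; positivity is only required
  almost everywhere, and the values of \<open>ln\<close> and \<open>powr\<close> at nonpositive arguments
  therefore matter only on null sets.\<close>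

definition L2 :: "'a measure \<Rightarrow> ('a \<Rightarrow> real ^ 'n) set"
  where "L2 M = {X \<in> borel_measurable M. \<forall>i. integrable M (\<lambda>\<omega>. \<bar>X \<omega> $ i\<bar>\<^sup>2)}"

definition Ln2 :: "'a measure \<Rightarrow> ('a \<Rightarrow> real ^ 'n) set"
  where "Ln2 M = {X \<in> borel_measurable M.
    (AE \<omega> in M. \<forall>i. 0 < X \<omega> $ i) \<and> (\<forall>i. integrable M (\<lambda>\<omega>. \<bar>ln (X \<omega> $ i)\<bar>\<^sup>2))}"

definition LLn2 :: "'a measure \<Rightarrow> ('a \<Rightarrow> real ^ 'n) set"
  where "LLn2 M = L2 M \<inter> Ln2 M"

definition vec_expectation :: "'a measure \<Rightarrow> ('a \<Rightarrow> real ^ 'n) \<Rightarrow> real ^ 'n"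
  where "vec_expectation M X = (\<chi> i. \<integral>\<omega>. X \<omega> $ i \<partial>M)"

definition vec_cond_exp :: "'a measure \<Rightarrow> 'a measure \<Rightarrow> ('a \<Rightarrow> real ^ 'n) \<Rightarrow> 'a \<Rightarrow> real ^ 'n"
  where "vec_cond_exp M G X = (\<lambda>\<omega>. \<chi> i. real_cond_exp M G (\<lambda>\<omega>'. X \<omega>' $ i) \<omega>)"

definition l_expectation :: "'a measure \<Rightarrow> ('a \<Rightarrow> real ^ 'n) \<Rightarrow> real ^ 'n"
  where "l_expectation M Y = vec_exp (vec_expectation M (\<lambda>\<omega>. vec_ln (Y \<omega>)))"

definition l_cond_exp :: "'a measure \<Rightarrow> 'a measure \<Rightarrow> ('a \<Rightarrow> real ^ 'n) \<Rightarrow> 'a \<Rightarrow> real ^ 'n"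
  where "l_cond_exp M G Y = (\<lambda>\<omega>. vec_exp (vec_cond_exp M G (\<lambda>\<omega>'. vec_ln (Y \<omega>')) \<omega>))"

end

theory Submission
  imports Defs
begin

text \<open>
  The logarithm turns every claim into a statement about ordinary conditional expectations. In the
  \<open>j\<close>-th coordinate, the \<open>\<ell>\<close>-conditional expectation of \<open>X\<close> is the exponential of the
  conditional expectation of \<open>ln (X $ j)\<close>, and this logarithm is integrable for
  \<open>X \<in> Ln2\<close>, because a square integrable function on a probability space is integrable. As
  \<open>ln\<close> undoes \<open>exp\<close>, iterating the \<open>\<ell>\<close>-conditional expectation iterates the ordinary one,
  and the tower property carries over. Almost everywhere the coordinates are positive and \<open>ln\<close>
  turns products of powers into linear combinations, so the rule for such products is linearity
  (\<open>real_cond_exp_weighted_sum\<close>).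

  The rule for independence holds because conditioning on an independent \<open>\<sigma>\<close>-algebra gives
  the constant expectation (\<open>real_cond_exp_indep\<close>): that constant is trivially measurable, and
  over a set \<open>A\<close> of the \<open>\<sigma>\<close>-algebra it has the right integral since the expectation of
  \<open>indicator A * f\<close> factors. Conditioning on the trivial \<open>\<sigma>\<close>-algebra is a special
  case, as every random variable is independent of it. There are only finitely many coordinates,
  so the union of their exceptional null sets is again null.
\<close>

lemma borel_measurable_vec_component [measurable (raw)]:
  fixes X :: "'a \<Rightarrow> real ^ 'n"
  assumes "X \<in> borel_measurable M"
  shows "(\<lambda>\<omega>. X \<omega> $ j) \<in> borel_measurable M"
proof -
  have "(\<lambda>v :: real ^ 'n. v $ j) \<in> borel_measurable borel"
    by (intro borel_measurable_continuous_onI continuous_intros)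
  from measurable_compose[OF assms this] show ?thesis .
qed

lemma prod_vec_component: "(\<Prod>i\<in>I. f i :: real ^ 'n) $ j = (\<Prod>i\<in>I. f i $ j)"
  by (induction I rule: infinite_finite_induct) auto

lemma l_cond_exp_component:
  "l_cond_exp M F X \<omega> $ j = exp (real_cond_exp M F (\<lambda>\<omega>'. ln (X \<omega>' $ j)) \<omega>)"
  by (simp add: l_cond_exp_def vec_exp_def vec_cond_exp_def vec_ln_def)

lemma AE_vec_eqI:
  fixes X Y :: "'a \<Rightarrow> 'b ^ 'n"
  assumes "\<And>j. AE \<omega> in M. X \<omega> $ j = Y \<omega> $ j"
  shows "AE \<omega> in M. X \<omega> = Y \<omega>"
  using assms by (simp add: vec_eq_iff AE_all_countable)

lemma Ln2_borel_measurable: "X \<in> Ln2 M \<Longrightarrow> X \<in> borel_measurable M"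
  by (simp add: Ln2_def)

lemma Ln2_AE_pos: "X \<in> Ln2 M \<Longrightarrow> AE \<omega> in M. 0 < X \<omega> $ j"
  by (auto simp: Ln2_def)

lemma (in prob_space) Ln2_integrable_ln:
  assumes "X \<in> Ln2 M"
  shows "integrable M (\<lambda>\<omega>. ln (X \<omega> $ j))"
proof (rule square_integrable_imp_integrable)
  note [measurable] = Ln2_borel_measurable[OF assms]
  show "(\<lambda>\<omega>. ln (X \<omega> $ j)) \<in> borel_measurable M"
    by measurable
  show "integrable M (\<lambda>\<omega>. (ln (X \<omega> $ j))\<^sup>2)"
    using assms by (simp add: Ln2_def)
qed

lemma (in prob_space) subalgebra_imp_sigma_finite_subalgebra:
  assumes "subalgebra M F"
  shows "sigma_finite_subalgebra M F"
proof -
  interpret finite_measure_subalgebra M F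
    by unfold_locales (rule assms)
  show ?thesis ..
qed

lemma (in sigma_finite_subalgebra) real_cond_exp_weighted_sum:
  fixes f :: "'b \<Rightarrow> 'a \<Rightarrow> real"
  assumes "finite I" "\<And>i. i \<in> I \<Longrightarrow> integrable M (f i)"
  shows "AE \<omega> in M. real_cond_exp M F (\<lambda>\<omega>. \<Sum>i\<in>I. c i * f i \<omega>) \<omega>
           = (\<Sum>i\<in>I. c i * real_cond_exp M F (f i) \<omega>)"
proof -
  \<comment> \<open>The sum rule for conditional expectations wants integrability at every index, so the
    family is extended by \<open>0\<close> outside \<open>I\<close>.\<close>
  define g where "g i = (if i \<in> I then \<lambda>\<omega>. c i * f i \<omega> else (\<lambda>_. 0))" for i
  have "AE \<omega> in M. real_cond_exp M F (\<lambda>\<omega>. \<Sum>i\<in>I. g i \<omega>) \<omega>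
          = (\<Sum>i\<in>I. real_cond_exp M F (g i) \<omega>)"
    by (rule real_cond_exp_sum) (simp add: g_def assms)
  moreover have "AE \<omega> in M. \<forall>i\<in>I. real_cond_exp M F (g i) \<omega> = c i * real_cond_exp M F (f i) \<omega>"
    using assms by (intro AE_finite_allI) (simp_all add: g_def real_cond_exp_cmult)
  ultimately show ?thesis
    by eventually_elim (simp add: g_def cong: sum.cong)
qed

lemma Int_stable_preimages: "Int_stable {X -` A \<inter> S | A. A \<in> sets N}"
proof (safe intro!: Int_stableI)
  fix A B assume "A \<in> sets N" "B \<in> sets N"
  then show "\<exists>C. (X -` A \<inter> S) \<inter> (X -` B \<inter> S) = X -` C \<inter> S \<and> C \<in> sets N"
    by (intro exI[of _ "A \<inter> B"]) auto
qed

text \<open>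
  Independence is assumed of the variable \<open>X\<close> and used for the function \<open>g\<close> of it, so
  that one independent random vector serves for the logarithms of all its coordinates.
\<close>

lemma (in prob_space) real_cond_exp_indep:
  fixes g :: "'b \<Rightarrow> real"
  assumes F: "subalgebra M F"
    and X: "X \<in> measurable M N" and g: "g \<in> borel_measurable N"
    and int: "integrable M (\<lambda>\<omega>. g (X \<omega>))"
    and indep: "indep_set {X -` A \<inter> space M | A. A \<in> sets N} (sets F)"
  shows "AE \<omega> in M. real_cond_exp M F (\<lambda>\<omega>. g (X \<omega>)) \<omega> = expectation (\<lambda>\<omega>. g (X \<omega>))"
proof -
  interpret F: sigma_finite_subalgebra M F
    using F by (rule subalgebra_imp_sigma_finite_subalgebra)
  show ?thesis
  proof (rule F.real_cond_exp_charact)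
    fix A assume A: "A \<in> sets F"
    with F have [measurable]: "A \<in> sets M"
      by (auto simp: subalgebra_def)
    have "indep_var borel (\<lambda>\<omega>. g (X \<omega>)) borel (indicator A :: 'a \<Rightarrow> real)"
      unfolding indep_var_eq
    proof (intro conjI indep_set_sigma_sets)
      have "{(\<lambda>\<omega>. g (X \<omega>)) -` B \<inter> space M | B. B \<in> sets borel}
          \<subseteq> {X -` A \<inter> space M | A. A \<in> sets N}"
      proof safe
        fix B :: "real set" assume "B \<in> sets borel"
        with g have "g -` B \<inter> space N \<in> sets N"
          by (rule measurable_sets)
        moreover have "(\<lambda>\<omega>. g (X \<omega>)) -` B \<inter> space M = X -` (g -` B \<inter> space N) \<inter> space M"
          using measurable_space[OF X] by auto
        ultimately show "\<exists>A. (\<lambda>\<omega>. g (X \<omega>)) -` B \<inter> space M = X -` A \<inter> space M \<and> A \<in> sets N"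
          by blast
      qed
      moreover have "{indicator A -` B \<inter> space M | B. B \<in> sets (borel :: real measure)} \<subseteq> sets F"
      proof safe
        fix B :: "real set" assume "B \<in> sets borel"
        moreover have "(indicator A :: 'a \<Rightarrow> real) \<in> borel_measurable F"
          using A by simp
        ultimately have "indicator A -` B \<inter> space F \<in> sets F"
          by (rule measurable_sets[rotated])
        with F show "indicator A -` B \<inter> space M \<in> sets F"
          by (simp add: subalgebra_def)
      qed
      ultimately show "indep_set {(\<lambda>\<omega>. g (X \<omega>)) -` B \<inter> space M | B. B \<in> sets borel}
          {indicator A -` B \<inter> space M | B. B \<in> sets (borel :: real measure)}"
        using indep unfolding indep_sets2_eq by (meson subset_iff)
    qed (use int in \<open>auto intro: Int_stable_preimages\<close>)
    then have "expectation (\<lambda>\<omega>. g (X \<omega>) * indicator A \<omega>)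
        = expectation (\<lambda>\<omega>. g (X \<omega>)) * expectation (indicator A)"
      using int by (subst indep_var_lebesgue_integral)
        (simp_all add: integrable_real_indicator emeasure_eq_measure)
    then show "(\<integral>\<omega>\<in>A. g (X \<omega>) \<partial>M) = (\<integral>\<omega>\<in>A. expectation (\<lambda>\<omega>. g (X \<omega>)) \<partial>M)"
      by (simp add: set_lebesgue_integral_def mult.commute)
  qed (use int in simp_all)
qed

lemma (in prob_space) indep_set_trivial_sigma:
  assumes "X \<in> measurable M N"
  shows "indep_set {X -` A \<inter> space M | A. A \<in> sets N} (sets (sigma (space M) {{}, space M}))"
proof -
  have "sets (sigma (space M) {{}, space M}) = {{}, space M}"
    by (simp add: sigma_algebra.sigma_sets_eq[OF sigma_algebra_trivial])
  then show ?thesis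
    using assms by (auto simp: indep_sets2_eq prob_space)
qed

lemma (in prob_space) l_cond_exp_indep:
  assumes F: "subalgebra M F" and Y: "Y \<in> Ln2 M"
    and indep: "indep_set {Y -` A \<inter> space M | A. A \<in> sets borel} (sets F)"
  shows "AE \<omega> in M. l_cond_exp M F Y \<omega> = l_expectation M Y"
proof (rule AE_vec_eqI)
  fix j
  have "AE \<omega> in M. real_cond_exp M F (\<lambda>\<omega>. ln (Y \<omega> $ j)) \<omega> = expectation (\<lambda>\<omega>. ln (Y \<omega> $ j))"
    using F Ln2_borel_measurable[OF Y] _ Ln2_integrable_ln[OF Y] indep
    by (rule real_cond_exp_indep) measurable
  then show "AE \<omega> in M. l_cond_exp M F Y \<omega> $ j = l_expectation M Y $ j"
    by eventually_elim
      (simp add: l_cond_exp_component l_expectation_def vec_exp_def vec_expectation_def vec_ln_def)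
qed

lemma (in prob_space) l_cond_exp_tower:
  assumes G: "subalgebra M G" and H: "subalgebra M H" and GH: "subalgebra G H" and Y: "Y \<in> Ln2 M"
  shows "AE \<omega> in M. l_cond_exp M H (l_cond_exp M G Y) \<omega> = l_cond_exp M H Y \<omega>"
proof (rule AE_vec_eqI)
  fix j
  interpret H: sigma_finite_subalgebra M H
    using H by (rule subalgebra_imp_sigma_finite_subalgebra)
  show "AE \<omega> in M. l_cond_exp M H (l_cond_exp M G Y) \<omega> $ j = l_cond_exp M H Y \<omega> $ j"
    using H.real_cond_exp_nested_subalg[OF G GH Ln2_integrable_ln[OF Y, of j]]
    by (simp add: l_cond_exp_component)
qed

lemma (in prob_space) l_cond_exp_prod_powr:
  assumes F: "subalgebra M F" and I: "finite I" and Z: "\<And>i. i \<in> I \<Longrightarrow> Z i \<in> Ln2 M"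
  shows "AE \<omega> in M. l_cond_exp M F (\<lambda>\<omega>'. \<Prod>i\<in>I. vec_powr (Z i \<omega>') (w i)) \<omega>
           = (\<Prod>i\<in>I. vec_powr (l_cond_exp M F (Z i) \<omega>) (w i))"
proof (rule AE_vec_eqI)
  fix j
  interpret F: sigma_finite_subalgebra M F
    using F by (rule subalgebra_imp_sigma_finite_subalgebra)
  let ?L = "\<lambda>i \<omega>. ln (Z i \<omega> $ j)"
  have [measurable]: "(\<lambda>\<omega>. Z i \<omega> $ j) \<in> borel_measurable M" if "i \<in> I" for i
    using Ln2_borel_measurable[OF Z[OF that]] by measurable
  have "AE \<omega> in M. \<forall>i\<in>I. 0 < Z i \<omega> $ j"
    using I Ln2_AE_pos[OF Z] by (rule AE_finite_allI)
  then have "AE \<omega> in M. ln (\<Prod>i\<in>I. (Z i \<omega> $ j) powr w i) = (\<Sum>i\<in>I. w i * ?L i \<omega>)"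
    by eventually_elim (simp add: ln_prod I less_imp_neq[symmetric])
  then have "AE \<omega> in M. real_cond_exp M F (\<lambda>\<omega>. ln (\<Prod>i\<in>I. (Z i \<omega> $ j) powr w i)) \<omega>
      = real_cond_exp M F (\<lambda>\<omega>. \<Sum>i\<in>I. w i * ?L i \<omega>) \<omega>"
    by (rule F.real_cond_exp_cong) measurable
  moreover have "AE \<omega> in M. real_cond_exp M F (\<lambda>\<omega>. \<Sum>i\<in>I. w i * ?L i \<omega>) \<omega>
      = (\<Sum>i\<in>I. w i * real_cond_exp M F (?L i) \<omega>)"
    using I Ln2_integrable_ln[OF Z] by (rule F.real_cond_exp_weighted_sum)
  ultimately show "AE \<omega> in M. l_cond_exp M F (\<lambda>\<omega>'. \<Prod>i\<in>I. vec_powr (Z i \<omega>') (w i)) \<omega> $ j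
      = (\<Prod>i\<in>I. vec_powr (l_cond_exp M F (Z i) \<omega>) (w i)) $ j"
    by eventually_elim
      (simp add: l_cond_exp_component prod_vec_component vec_powr_def powr_def exp_sum I)
qed

theorem theorem3p2:
  fixes M G H :: "'a measure" and Y :: "'a \<Rightarrow> real ^ 'n"
  assumes "prob_space M"
    and "Y \<in> LLn2 M"
    and "subalgebra M G" and "subalgebra M H" and "subalgebra G H"
  shows
    "(AE \<omega> in M. l_cond_exp M (sigma (space M) {{}, space M}) Y \<omega> = l_expectation M Y) \<and>
     (AE \<omega> in M. l_cond_exp M H (l_cond_exp M G Y) \<omega> = l_cond_exp M H Y \<omega>) \<and>
     (\<forall>(k::nat) (Z :: nat \<Rightarrow> 'a \<Rightarrow> real ^ 'n) (w :: nat \<Rightarrow> real).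
        (\<forall>i\<in>{1..k}. Z i \<in> LLn2 M) \<longrightarrow>
        (AE \<omega> in M. l_cond_exp M G (\<lambda>\<omega>'. \<Prod>i=1..k. vec_powr (Z i \<omega>') (w i)) \<omega> =
                   (\<Prod>i=1..k. vec_powr (l_cond_exp M G (Z i) \<omega>) (w i)))) \<and>
     (prob_space.indep_set M {Y -` A \<inter> space M | A. A \<in> sets borel} (sets G) \<longrightarrow>
        (AE \<omega> in M. l_cond_exp M G Y \<omega> = l_expectation M Y))"
proof -
  interpret prob_space M
    by fact
  have Y: "Y \<in> Ln2 M"
    using assms(2) by (simp add: LLn2_def)
  have trivial: "subalgebra M (sigma (space M) {{}, space M})"
    by (auto simp: subalgebra_def intro!: sets.sigma_sets_subset)
  show ?thesis
  proof (intro conjI allI impI)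
    show "AE \<omega> in M. l_cond_exp M (sigma (space M) {{}, space M}) Y \<omega> = l_expectation M Y"
      using trivial Y indep_set_trivial_sigma[OF Ln2_borel_measurable[OF Y]]
      by (rule l_cond_exp_indep)
    show "AE \<omega> in M. l_cond_exp M H (l_cond_exp M G Y) \<omega> = l_cond_exp M H Y \<omega>"
      using assms(3-5) Y by (rule l_cond_exp_tower)
  next
    fix k :: nat and Z :: "nat \<Rightarrow> 'a \<Rightarrow> real ^ 'n" and w :: "nat \<Rightarrow> real"
    assume "\<forall>i\<in>{1..k}. Z i \<in> LLn2 M"
    then show "AE \<omega> in M. l_cond_exp M G (\<lambda>\<omega>'. \<Prod>i=1..k. vec_powr (Z i \<omega>') (w i)) \<omega>
        = (\<Prod>i=1..k. vec_powr (l_cond_exp M G (Z i) \<omega>) (w i))"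
      using assms(3) by (intro l_cond_exp_prod_powr) (auto simp: LLn2_def)
  next
    assume "indep_set {Y -` A \<inter> space M | A. A \<in> sets borel} (sets G)"
    with assms(3) Y show "AE \<omega> in M. l_cond_exp M G Y \<omega> = l_expectation M Y"
      by (rule l_cond_exp_indep)
  qed
qed

end
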